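(* Let $m\in\mathbb N$ and let $x^*\in\mathbb R^m$ be fixed. Let $\Psi\colon\mathbb R^m\to\mathbb R^m$ be a $t$-averaged operator with $t\in[\tfrac12,1]$. For a scaling factor $0<\gamma<2$, the mapping $\mathcal D\colon\mathbb R^m\to\mathbb R^m$ given by $$\mathcal D(x)=\Bigl(1-\frac{1}{1-\gamma+2t\gamma}\Bigr)x^*+\frac{1}{1-\gamma+2t\gamma}\bigl(x-\gamma\Psi(x)\bigr)$$ is $\tilde t$-averaged with $\tilde t=\dfrac{t\gamma}{1-\gamma+2t\gamma}$.
   Context: An operator $A\colon\mathbb R^m\to\mathbb R^m$ is $t$-averaged if there exists a non-expansive (i.e. $1$-Lipschitz with respect to the Euclidean norm) operator $R\colon\mathbb R^m\to\mathbb R^m$ such that $A=tR+(1-t)I_m$, where $I_m$ is the identity. For $t\in(0,1)$ this is the usual notion; for $t=1$ it just means that $A$ is non-expansive. That $\mathcal D$ is $\tilde t$-averaged is meant in the usual sense, in particular with $\tilde t\in(0,1)$. *)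

theory Defs
  imports "HOL-Analysis.Analysis"
begin

text \<open>The range of \<open>t\<close> is not part of the definition: it is \<open>(0,1)\<close> in the usual notion,
  and \<open>t = 1\<close> just says that \<open>A\<close> is non-expansive.\<close>

definition averaged :: "real \<Rightarrow> (real ^ 'm \<Rightarrow> real ^ 'm) \<Rightarrow> bool" where
  "averaged t A \<longleftrightarrow>
     (\<exists>R. 1-lipschitz_on UNIV R \<and> (\<forall>x. A x = t *\<^sub>R R x + (1 - t) *\<^sub>R x))"

end

theory Submission
  imports Defs
begin

text \<open>Write \<open>\<Psi> = t R + (1 - t) I\<close> with \<open>R\<close> non-expansive, and
  \<open>c = 1 - \<gamma> + 2 t \<gamma>\<close>, so that \<open>c \<ge> 1\<close> because \<open>t \<ge> 1/2\<close>. Then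
  \<open>x - \<gamma> \<Psi> x = t \<gamma> (- R x) + (c - t \<gamma>) x\<close>,
  whose two coefficients add up to \<open>c\<close>: the denominator in \<open>\<D>\<close> is exactly the one that makes
  this a combination of \<open>- R\<close> and the identity with weights \<open>t \<gamma> / c\<close> and
  \<open>1 - t \<gamma> / c\<close>. Since \<open>t \<gamma> > 0\<close>, the constant multiple of \<open>x\<^sup>*\<close> can be moved into the
  non-expansive part as a translation, and neither a sign change nor a translation affects a
  Lipschitz constant. The weight is less than \<open>1\<close> because \<open>c - t \<gamma> = 1 - \<gamma> (1 - t)\<close> and
  \<open>\<gamma> (1 - t) \<le> \<gamma> / 2 < 1\<close>.\<close>

lemma lipschitz_on_const_minus:
  fixes f :: "'a::metric_space \<Rightarrow> 'b::real_normed_vector"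
  assumes "L-lipschitz_on S f"
  shows "L-lipschitz_on S (\<lambda>x. w - f x)"
  using assms by (simp add: lipschitz_on_def dist_norm norm_minus_commute)

theorem lemma18:
  fixes xstar :: "real ^ 'm"
    and \<Psi> \<D> :: "real ^ 'm \<Rightarrow> real ^ 'm"
    and t \<gamma> :: real
  assumes "t \<in> {1/2..1}"
    and "averaged t \<Psi>"
    and "0 < \<gamma>" and "\<gamma> < 2"
    and "\<And>x. \<D> x = (1 - 1 / (1 - \<gamma> + 2 * t * \<gamma>)) *\<^sub>R xstar
                  + (1 / (1 - \<gamma> + 2 * t * \<gamma>)) *\<^sub>R (x - \<gamma> *\<^sub>R \<Psi> x)"
  shows "t * \<gamma> / (1 - \<gamma> + 2 * t * \<gamma>) \<in> {0<..<1}
       \<and> averaged (t * \<gamma> / (1 - \<gamma> + 2 * t * \<gamma>)) \<D>"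
proof -
  define c where "c = 1 - \<gamma> + 2 * t * \<gamma>"
  have t: "1/2 \<le> t" "t \<le> 1"
    using assms(1) by auto
  have t\<gamma>: "0 < t * \<gamma>"
    using t(1) assms(3) by simp
  have "\<gamma> * (1/2) \<le> \<gamma> * t"
    using t(1) assms(3) by (intro mult_left_mono) auto
  then have c: "1 \<le> c" and less: "t * \<gamma> < c"
    using assms(4) by (auto simp: c_def algebra_simps)
  obtain R where R: "1-lipschitz_on UNIV R"
    and \<Psi>: "\<And>x. \<Psi> x = t *\<^sub>R R x + (1 - t) *\<^sub>R x"
    using assms(2) unfolding averaged_def by blast
  \<comment> \<open>Dividing by \<open>t \<gamma>\<close> compensates the weight \<open>t \<gamma> / c\<close> that multiplies the translation.\<close>
  define w where "w = ((c - 1) / (t * \<gamma>)) *\<^sub>R xstar"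
  have "\<D> x = (t * \<gamma> / c) *\<^sub>R (w - R x) + (1 - t * \<gamma> / c) *\<^sub>R x" for x
  proof -
    have step: "x - \<gamma> *\<^sub>R \<Psi> x = (c - t * \<gamma>) *\<^sub>R x - (t * \<gamma>) *\<^sub>R R x"
      by (simp add: \<Psi> c_def algebra_simps flip: scaleR_left.add)
    have "\<D> x = (1 - 1 / c) *\<^sub>R xstar + (1 / c) *\<^sub>R ((c - t * \<gamma>) *\<^sub>R x - (t * \<gamma>) *\<^sub>R R x)"
      using assms(5)[of x] step by (simp add: c_def)
    also have "\<dots> = ((c - 1) / c) *\<^sub>R xstar - (t * \<gamma> / c) *\<^sub>R R x + (1 - t * \<gamma> / c) *\<^sub>R x"
      using c by (simp add: scaleR_diff_right diff_divide_distrib)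
    also have "((c - 1) / c) *\<^sub>R xstar = (t * \<gamma> / c) *\<^sub>R w"
      using t assms(3) by (simp add: w_def)
    finally show ?thesis
      by (simp add: scaleR_diff_right)
  qed
  then have "averaged (t * \<gamma> / c) \<D>"
    unfolding averaged_def using lipschitz_on_const_minus[OF R] by blast
  moreover have "t * \<gamma> / c \<in> {0<..<1}"
    using t\<gamma> c less by simp
  ultimately show ?thesis
    by (simp add: c_def)
qed

end
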